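(* Let $\mathcal A$ be a finite deterministic partial automaton over the alphabet $\{0,1\}$, with a specified initial state and a specified set of accepting states. For $k\geq0$ let $a_k$ be the number of binary words of length $k$ accepted by $\mathcal A$. Then for every $k$, exactly $a_k$ residue classes modulo $2^k$ have a parity vector of length $k$ accepted by $\mathcal A$. Moreover, let $M$ be the transfer matrix of $\mathcal A$, whose $(i,j)$ entry is the number of symbols in $\{0,1\}$ taking state $i$ to state $j$. Then $$a_k=u^{\mathsf T}M^kv,$$ where $u$ is the indicator vector of the initial state and $v$ is the indicator vector of the set of accepting states. Consequently, $(a_k)$ satisfies a linear recurrence with constant coefficients determined by the characteristic polynomial of $M$: if $\chi_M(x)=x^d+c_{d-1}x^{d-1}+\cdots+c_0$ is the characteristic polynomial of $M$, then $a_{k+d}+c_{d-1}a_{k+d-1}+\cdots+c_0a_k=0$ for all $k\geq0$.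
   Context: $\mathbb N$ denotes the positive integers. The Collatz function $T:\mathbb N\to\mathbb N$ is $T(n)=n/2$ if $n$ is even and $T(n)=(3n+1)/2$ if $n$ is odd; $T^0(s)=s$ and $T^k(s)=T(T^{k-1}(s))$ for $k\geq1$. For $s\in\mathbb N$ put $p_k(s)=T^k(s)\bmod 2\in\{0,1\}$; the parity vector of $s$ of length $k$ is $P_k(s)=(p_0(s),\dots,p_{k-1}(s))\in\{0,1\}^k$. It depends only on the residue of $s$ modulo $2^k$, so one may speak of the parity vector of length $k$ of a residue class modulo $2^k$. A deterministic partial automaton has a finite state set and, for each state and each symbol, at most one transition; a word is accepted if reading it from the initial state is possible at every step (all needed transitions are defined) and ends in an accepting state. *)

theory Defs
  imports "Jordan_Normal_Form.Char_Poly" "HOL-Number_Theory.Cong"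
begin

definition collatz :: "nat \<Rightarrow> nat" where
  "collatz n = (if even n then n div 2 else (3 * n + 1) div 2)"

definition parity_vector :: "nat \<Rightarrow> nat \<Rightarrow> nat list" where
  "parity_vector k s = map (\<lambda>i. (collatz ^^ i) s mod 2) [0..<k]"

text \<open>Residue classes modulo \<open>2 ^ k\<close> are taken as sets of positive integers; every class of integers
  contains positive ones, so there are \<open>2 ^ k\<close> of them.\<close>

definition residue_classes :: "nat \<Rightarrow> nat set set" where
  "residue_classes k = {0<..} // {(s, t). 0 < s \<and> 0 < t \<and> [s = t] (mod 2 ^ k)}"

text \<open>All elements of a class modulo \<open>2 ^ k\<close> have the same parity vector of length \<open>k\<close>; this is
  lemma \<open>class_parity_vector_eq\<close> below.\<close>

definition class_parity_vector :: "nat \<Rightarrow> nat set \<Rightarrow> nat list" where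
  "class_parity_vector k C = the_elem (parity_vector k ` C)"

lemma collatz_cong:
  assumes "[s = t] (mod 2 ^ Suc k)"
  shows "s mod 2 = t mod 2" and "[collatz s = collatz t] (mod 2 ^ k)"
proof -
  show par: "s mod 2 = t mod 2"
    using cong_dvd_modulus_nat[OF assms, of 2] by (simp add: cong_def)
  have div_mod: "(x mod 2 ^ Suc k) div 2 = x div 2 mod 2 ^ k" for x :: nat
    unfolding power_Suc mod_mult2_eq by simp
  have halve: "[x div 2 = y div 2] (mod 2 ^ k)"
    if "[x = y] (mod 2 ^ Suc k)" for x y :: nat
    using arg_cong[OF that[unfolded cong_def], of "\<lambda>z. z div 2"] by (simp only: div_mod cong_def)
  have "[3 * s + 1 = 3 * t + 1] (mod 2 ^ Suc k)"
    using assms by (intro cong_add cong_mult) auto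
  moreover have "even s \<longleftrightarrow> even t"
    using par unfolding even_iff_mod_2_eq_zero by (rule arg_cong)
  ultimately show "[collatz s = collatz t] (mod 2 ^ k)"
    using assms by (simp only: collatz_def halve split: if_split) simp
qed

lemma parity_vector_cong:
  "[s = t] (mod 2 ^ k) \<Longrightarrow> parity_vector k s = parity_vector k t"
proof (induction k arbitrary: s t)
  case 0
  show ?case by (simp add: parity_vector_def)
next
  case (Suc k)
  have step: "parity_vector (Suc k) x = x mod 2 # parity_vector k (collatz x)" for x
    by (simp only: parity_vector_def map_upt_Suc funpow_0 funpow_Suc_right comp_apply)
  show ?case
    using collatz_cong[OF Suc.prems] Suc.IH by (simp add: step)
qed

lemma class_parity_vector_eq:
  assumes "C \<in> residue_classes k" "s \<in> C"
  shows "class_parity_vector k C = parity_vector k s"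
proof -
  have "parity_vector k t = parity_vector k s" if "t \<in> C" for t
    using assms that unfolding residue_classes_def quotient_def
    by (auto intro!: parity_vector_cong intro: cong_sym cong_trans)
  with assms(2) have "parity_vector k ` C = {parity_vector k s}" by blast
  then show ?thesis by (simp add: class_parity_vector_def)
qed

record 'q automaton =
  states :: "'q set"
  init :: 'q
  accepting :: "'q set"
  trans :: "'q \<Rightarrow> nat \<Rightarrow> 'q option"

definition wf_automaton :: "'q automaton \<Rightarrow> bool" where
  "wf_automaton A \<longleftrightarrow> finite (states A) \<and> init A \<in> states A \<and> accepting A \<subseteq> states A \<and>
     (\<forall>q\<in>states A. \<forall>b\<in>{0, 1}. \<forall>q'. trans A q b = Some q' \<longrightarrow> q' \<in> states A)"

fun run :: "'q automaton \<Rightarrow> 'q \<Rightarrow> nat list \<Rightarrow> 'q option" where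
  "run A q [] = Some q"
| "run A q (b # w) = (case trans A q b of None \<Rightarrow> None | Some q' \<Rightarrow> run A q' w)"

definition accepts :: "'q automaton \<Rightarrow> nat list \<Rightarrow> bool" where
  "accepts A w \<longleftrightarrow> (\<exists>q\<in>accepting A. run A (init A) w = Some q)"

definition num_accepted :: "'q automaton \<Rightarrow> nat \<Rightarrow> nat" where
  "num_accepted A k = card {w. length w = k \<and> set w \<subseteq> {0, 1} \<and> accepts A w}"

text \<open>Matrices and vectors are indexed by \<open>{..<d}\<close> for the number \<open>d\<close> of states; \<open>e\<close> is an
  enumeration of the states.\<close>

definition transfer_matrix :: "'q automaton \<Rightarrow> (nat \<Rightarrow> 'q) \<Rightarrow> int mat" where
  "transfer_matrix A e = mat (card (states A)) (card (states A))
     (\<lambda>(i, j). int (card {b \<in> {0, 1}. trans A (e i) b = Some (e j)}))"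

definition indicator_vec :: "'q automaton \<Rightarrow> (nat \<Rightarrow> 'q) \<Rightarrow> 'q set \<Rightarrow> int vec" where
  "indicator_vec A e S = vec (card (states A)) (\<lambda>i. if e i \<in> S then 1 else 0)"

end

theory Submission
  imports Defs
begin

text \<open>
  The map sending a residue class modulo \<open>2 ^ k\<close> to its parity vector is injective, because
  \<open>collatz s\<close> and the parity of \<open>s\<close> determine \<open>2 * s\<close> or \<open>3 * s\<close>; counting makes it a bijection
  onto the binary words.  The numbers of words accepted from the individual states satisfy the
  first-order system with matrix \<open>M\<close>.  Its solutions are annihilated by \<open>char_poly M\<close>: letting the
  indeterminate act on sequences as the shift, the system says that the matrix \<open>x I - M\<close> kills the
  vector of solutions, and multiplication by the adjugate turns this into the claim.
\<close>

subsection \<open>Parity vectors of residue classes\<close>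

lemma parity_vector_Suc: "parity_vector (Suc k) s = s mod 2 # parity_vector k (collatz s)"
  by (simp only: parity_vector_def map_upt_Suc funpow_0 funpow_Suc_right comp_apply)

text \<open>Both halvings in \<open>collatz\<close> are exact, so doubling removes the division and
  leaves an affine expression in \<open>s\<close>.\<close>

lemma two_mult_collatz: "2 * collatz s = (if even s then s else 3 * s + 1)"
  by (simp add: collatz_def)

text \<open>Converse of \<open>parity_vector_cong\<close>. Equal first parities select the same
  branch of \<open>collatz\<close>, and that branch can be inverted modulo \<open>2 ^ Suc k\<close>
  because 3 is a unit there.\<close>

lemma cong_if_parity_vector_eq:
  "parity_vector k s = parity_vector k t \<Longrightarrow> [s = t] (mod 2 ^ k)"
proof (induction k arbitrary: s t)
  case 0
  show ?case by (simp add: cong_def)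
next
  case (Suc k)
  then have "s mod 2 = t mod 2" "parity_vector k (collatz s) = parity_vector k (collatz t)"
    unfolding parity_vector_Suc by blast+
  then have par: "even s \<longleftrightarrow> even t" and "[collatz s = collatz t] (mod 2 ^ k)"
    by (simp_all only: even_iff_mod_2_eq_zero Suc.IH)
  \<comment> \<open>Doubling both sides also doubles the modulus, which gains the extra binary
    digit.\<close>
  then have dbl: "[2 * collatz s = 2 * collatz t] (mod 2 ^ Suc k)"
    by (simp only: cong_def power_Suc flip: mult_mod_right)
  show ?case
  proof (cases "even s")
    case True
    with dbl par show ?thesis by (simp only: two_mult_collatz if_True)
  next
    case False
    with dbl par have "[3 * s + 1 = 3 * t + 1] (mod 2 ^ Suc k)"
      by (simp only: two_mult_collatz if_False)
    then have "[3 * s = 3 * t] (mod 2 ^ Suc k)"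
      by (simp only: cong_add_rcancel_nat)
    moreover have "coprime (3 :: nat) (2 ^ Suc k)"
      using coprime_Suc_left_nat[of 2] by (simp del: power_Suc)
    ultimately show ?thesis
      by (simp only: cong_mult_lcancel_nat)
  qed
qed

abbreviation binary_words :: "nat \<Rightarrow> nat list set" where
  "binary_words k \<equiv> {w. length w = k \<and> set w \<subseteq> {0, 1}}"

lemma finite_binary_words: "finite (binary_words k)"
  using finite_lists_length_eq[of "{0, 1 :: nat}" k] by (simp add: conj_commute)

lemma parity_vector_in_binary_words: "parity_vector k s \<in> binary_words k"
  by (auto simp: parity_vector_def)

text \<open>The \<open>2 ^ k\<close> numbers from 1 to \<open>2 ^ k\<close> have distinct parity
  vectors, and there are only \<open>2 ^ k\<close> binary words.\<close>

lemma parity_vector_surj: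
  assumes "w \<in> binary_words k"
  obtains s where "s > 0" "parity_vector k s = w"
proof -
  have "inj_on (parity_vector k) {1..2 ^ k}"
  proof (rule inj_onI)
    fix s t :: nat
    assume st: "s \<in> {1..2 ^ k}" "t \<in> {1..2 ^ k}" and "parity_vector k s = parity_vector k t"
    then have "[s = t] (mod 2 ^ k)"
      by (intro cong_if_parity_vector_eq)
    \<comment> \<open>The representatives start at 1; subtracting 1 puts them below the modulus,
      where congruence forces equality.\<close>
    moreover have "s = (s - 1) + 1" "t = (t - 1) + 1"
      using st by simp_all
    ultimately have "[(s - 1) + 1 = (t - 1) + 1] (mod 2 ^ k)"
      by metis
    then have "[s - 1 = t - 1] (mod 2 ^ k)"
      by (simp only: cong_add_rcancel_nat)
    with st show "s = t"
      using cong_less_modulus_unique_nat[of "s - 1" "t - 1" "2 ^ k"] by force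
  qed
  then have "card (parity_vector k ` {1..2 ^ k}) = 2 ^ k"
    by (simp add: card_image)
  moreover have "card (binary_words k) = 2 ^ k"
    using card_lists_length_eq[of "{0, 1 :: nat}" k] by (simp add: conj_commute numeral_2_eq_2)
  ultimately have "parity_vector k ` {1..2 ^ k} = binary_words k"
    by (intro card_subset_eq finite_binary_words image_subsetI parity_vector_in_binary_words) simp
  with assms obtain s where "s \<in> {1..2 ^ k}" "w = parity_vector k s"
    by (metis (no_types, lifting) imageE)
  then show ?thesis by (intro that[of s]) simp_all
qed

lemma bij_betw_class_parity_vector:
  "bij_betw (class_parity_vector k) (residue_classes k) (binary_words k)"
proof -
  define r :: "(nat \<times> nat) set" where "r = {(s, t). 0 < s \<and> 0 < t \<and> [s = t] (mod 2 ^ k)}"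
  have equiv: "equiv {0<..} r"
    unfolding r_def by (rule equivI) (auto intro!: refl_onI symI transI intro: cong_sym cong_trans)
  have classes: "residue_classes k = {0<..} // r"
    by (simp add: residue_classes_def r_def)
  \<comment> \<open>Together with \<open>repE\<close>, this reduces statements about classes to
    positive representatives.\<close>
  have rep: "r `` {s} \<in> residue_classes k" "class_parity_vector k (r `` {s}) = parity_vector k s"
    if "s > 0" for s
  proof -
    show mem: "r `` {s} \<in> residue_classes k"
      unfolding classes using that by (auto intro: quotientI)
    have "s \<in> r `` {s}" using that by (simp add: r_def)
    with mem show "class_parity_vector k (r `` {s}) = parity_vector k s"
      by (rule class_parity_vector_eq)
  qed
  have repE: "\<exists>s>0. C = r `` {s}" if "C \<in> residue_classes k" for C
    using that unfolding classes by (auto elim: quotientE)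
  show ?thesis
  proof (rule bij_betw_imageI)
    show "inj_on (class_parity_vector k) (residue_classes k)"
    proof (rule inj_onI)
      fix C D
      assume "C \<in> residue_classes k" "D \<in> residue_classes k"
        and eq: "class_parity_vector k C = class_parity_vector k D"
      then obtain s t where st: "s > 0" "C = r `` {s}" "t > 0" "D = r `` {t}"
        using repE by metis
      with eq have "[s = t] (mod 2 ^ k)"
        by (simp add: rep cong_if_parity_vector_eq)
      with st have "(s, t) \<in> r" by (simp add: r_def)
      with st equiv show "C = D" by (simp add: equiv_class_eq)
    qed
    show "class_parity_vector k ` residue_classes k = binary_words k"
    proof
      show "class_parity_vector k ` residue_classes k \<subseteq> binary_words k"
        by (metis (no_types, lifting) image_subsetI parity_vector_in_binary_words rep(2) repE)
      show "binary_words k \<subseteq> class_parity_vector k ` residue_classes k"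
        by (metis (no_types, lifting) image_eqI parity_vector_surj rep subsetI)
    qed
  qed
qed

lemma card_accepted_residue_classes:
  "card {C \<in> residue_classes k. accepts A (class_parity_vector k C)} = num_accepted A k"
proof -
  have "class_parity_vector k ` {C \<in> residue_classes k. accepts A (class_parity_vector k C)} =
      {w \<in> class_parity_vector k ` residue_classes k. accepts A w}"
    by blast
  also have "class_parity_vector k ` residue_classes k = binary_words k"
    using bij_betw_class_parity_vector by (rule bij_betw_imp_surj_on)
  finally have "class_parity_vector k ` {C \<in> residue_classes k. accepts A (class_parity_vector k C)} =
      {w \<in> binary_words k. accepts A w}" .
  then have "bij_betw (class_parity_vector k)
      {C \<in> residue_classes k. accepts A (class_parity_vector k C)} {w \<in> binary_words k. accepts A w}"
    by (intro bij_betw_subset[OF bij_betw_class_parity_vector]) auto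
  then show ?thesis
    using bij_betw_same_card by (fastforce simp: num_accepted_def conj_assoc)
qed

subsection \<open>Linear systems of recurrences\<close>

text \<open>This is \<open>p(E) f\<close> evaluated at \<open>k\<close>, where \<open>E\<close> is
  the shift operator. It makes sequences a module over the polynomial ring, so a linear recurrence
  says that a polynomial annihilates a sequence.\<close>

definition shift_act :: "'a::comm_ring_1 poly \<Rightarrow> (nat \<Rightarrow> 'a) \<Rightarrow> nat \<Rightarrow> 'a" where
  "shift_act p f k = (\<Sum>i\<le>degree p. coeff p i * f (k + i))"

lemma shift_act_0 [simp]: "shift_act 0 f k = 0"
  by (simp add: shift_act_def)

lemma shift_act_1 [simp]: "shift_act 1 f k = f k"
  by (simp add: shift_act_def)

text \<open>Multiplication by the indeterminate advances the index. This drives the polynomial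
  inductions below; \<open>p = 0\<close> is separate because the degree then does not grow.\<close>

lemma shift_act_pCons [simp]: "shift_act (pCons a p) f k = a * f k + shift_act p f (Suc k)"
  by (cases "p = 0")
    (simp_all add: shift_act_def sum.atMost_Suc_shift del: sum.atMost_Suc)

lemma shift_act_add: "shift_act (p + q) f k = shift_act p f k + shift_act q f k"
  by (induction p q arbitrary: k rule: poly_induct2) (simp_all add: algebra_simps)

lemma shift_act_smult: "shift_act (Polynomial.smult a p) f k = a * shift_act p f k"
  by (induction p arbitrary: k) (simp_all add: algebra_simps)

lemma shift_act_mult: "shift_act (p * q) f k = shift_act p (shift_act q f) k"
  by (induction p arbitrary: k) (simp_all add: shift_act_add shift_act_smult)

lemma shift_act_sum: "shift_act (\<Sum>i\<in>I. p i) f k = (\<Sum>i\<in>I. shift_act (p i) f k)"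
  by (induction I rule: infinite_finite_induct) (simp_all add: shift_act_add)

lemma shift_act_zero_right: "shift_act p (\<lambda>k. 0) k = 0"
  by (simp add: shift_act_def)

lemma shift_act_sum_right:
  "shift_act p (\<lambda>k. \<Sum>i\<in>I. f i k) k = (\<Sum>i\<in>I. shift_act p (f i) k)"
  by (induction p arbitrary: k) (simp_all add: sum.distrib sum_distrib_left)

text \<open>The determinant trick: row \<open>l\<close> of the identity adjugate times
  \<open>?B\<close> equals \<open>det ?B\<close> times the unit matrix is applied to the vector of
  sequences. It needs no division, so any commutative ring will do.\<close>

lemma char_poly_shift_act:
  fixes M :: "'a::comm_ring_1 mat" and f :: "nat \<Rightarrow> nat \<Rightarrow> 'a"
  assumes M: "M \<in> carrier_mat n n"
    and f: "\<And>i k. i < n \<Longrightarrow> f i (Suc k) = (\<Sum>j<n. M $$ (i, j) * f j k)"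
    and l: "l < n"
  shows "shift_act (char_poly M) (f l) k = 0"
proof -
  let ?B = "char_poly_matrix M"
  let ?adj = "adj_mat ?B"
  have B: "?B \<in> carrier_mat n n" using M by simp
  note adj = adj_mat[OF B]
  \<comment> \<open>A diagonal entry of \<open>?B\<close> contributes one shift, and every entry
    subtracts its scalar from \<open>M\<close>; the row sum is thus the difference of the two sides
    of \<open>f\<close>.\<close>
  have system: "(\<Sum>j<n. shift_act (?B $$ (i, j)) (f j) k) = 0" if "i < n" for i k
  proof -
    have "shift_act (?B $$ (i, j)) (f j) k =
        (if i = j then f j (Suc k) else 0) - M $$ (i, j) * f j k" if "j < n" for j
      using M \<open>i < n\<close> that by (simp add: char_poly_matrix_def shift_act_add)
    then show ?thesis
      using that by (simp add: sum_subtractf f)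
  qed
  have "shift_act (char_poly M) (f l) k = (\<Sum>j<n. shift_act ((?adj * ?B) $$ (l, j)) (f j) k)"
  proof -
    have "shift_act ((?adj * ?B) $$ (l, j)) (f j) k =
        (if l = j then shift_act (char_poly M) (f j) k else 0)" if "j < n" for j
      using l that by (simp add: adj(3) char_poly_def)
    then show ?thesis using l by simp
  qed
  also have "\<dots> = (\<Sum>j<n. \<Sum>i<n. shift_act (?adj $$ (l, i)) (shift_act (?B $$ (i, j)) (f j)) k)"
  proof (rule sum.cong[OF refl])
    fix j assume "j \<in> {..<n}"
    with l B adj(1) have "(?adj * ?B) $$ (l, j) = (\<Sum>i<n. ?adj $$ (l, i) * ?B $$ (i, j))"
      by (simp add: scalar_prod_def atLeast0LessThan)
    then show "shift_act ((?adj * ?B) $$ (l, j)) (f j) k =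
        (\<Sum>i<n. shift_act (?adj $$ (l, i)) (shift_act (?B $$ (i, j)) (f j)) k)"
      by (simp add: shift_act_sum shift_act_mult)
  qed
  \<comment> \<open>After exchanging the sums, each adjugate entry acts on a whole row of the
    system, which is the zero sequence.\<close>
  also have "\<dots> =
      (\<Sum>i<n. shift_act (?adj $$ (l, i)) (\<lambda>k. \<Sum>j<n. shift_act (?B $$ (i, j)) (f j) k) k)"
    unfolding shift_act_sum_right by (rule sum.swap)
  also have "\<dots> = 0"
    by (simp add: system shift_act_zero_right)
  finally show ?thesis .
qed

text \<open>Each factor \<open>M\<close> advances the vector by one index. The power unfolds with
  \<open>M\<close> on the right, next to the vector, so the induction needs its hypothesis at
  \<open>Suc m\<close>.\<close>

lemma pow_mat_mult_vec_system:
  fixes M :: "'a::comm_ring_1 mat" and f :: "nat \<Rightarrow> nat \<Rightarrow> 'a"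
  assumes M: "M \<in> carrier_mat n n"
    and f: "\<And>i k. i < n \<Longrightarrow> f i (Suc k) = (\<Sum>j<n. M $$ (i, j) * f j k)"
  shows "(M ^\<^sub>m k) *\<^sub>v vec n (\<lambda>i. f i m) = vec n (\<lambda>i. f i (m + k))"
proof (induction k arbitrary: m)
  case 0
  show ?case using M by simp
next
  case (Suc k)
  have "M *\<^sub>v vec n (\<lambda>i. f i m) = vec n (\<lambda>i. f i (Suc m))"
    using M by (intro eq_vecI) (auto simp: f scalar_prod_def atLeast0LessThan)
  with Suc[of "Suc m"] show ?case
    using assoc_mult_mat_vec[OF pow_carrier_mat[OF M] M] by simp
qed

lemma char_poly_eq_monom_sum:
  fixes M :: "'a::comm_ring_1 mat"
  assumes M: "M \<in> carrier_mat n n"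
  shows "char_poly M = monom 1 n + (\<Sum>i<n. monom (coeff (char_poly M) i) i)"
proof -
  have "char_poly M = (\<Sum>i<Suc n. monom (coeff (char_poly M) i) i)"
    using poly_as_sum_of_monoms[of "char_poly M"] degree_monic_char_poly[OF M]
    by (simp add: lessThan_Suc_atMost)
  then show ?thesis
    using degree_monic_char_poly[OF M] by (simp add: add.commute)
qed

subsection \<open>Counting accepted words\<close>

text \<open>The counts for a single initial state need not satisfy a first-order recurrence by
  themselves; the family over all states does.\<close>

definition num_accepted_from :: "'q automaton \<Rightarrow> 'q \<Rightarrow> nat \<Rightarrow> nat" where
  "num_accepted_from A q k = num_accepted (A\<lparr>init := q\<rparr>) k"

lemma accepts_Cons:
  "accepts A (b # w) \<longleftrightarrow> (\<exists>q. trans A (init A) b = Some q \<and> accepts (A\<lparr>init := q\<rparr>) w)"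
proof -
  \<comment> \<open>\<open>run\<close> takes its start state as an argument and never reads the
    field \<open>init\<close>.\<close>
  have "run (A\<lparr>init := q\<rparr>) p w = run A p w" for p q
    by (induction w arbitrary: p) (auto split: option.splits)
  then show ?thesis by (auto simp: accepts_def split: option.splits)
qed

lemma num_accepted_from_0: "num_accepted_from A q 0 = (if q \<in> accepting A then 1 else 0)"
proof -
  have "{w. length w = 0 \<and> set w \<subseteq> {0, 1} \<and> accepts (A\<lparr>init := q\<rparr>) w} =
      (if q \<in> accepting A then {[]} else {})"
    by (auto simp: accepts_def)
  then show ?thesis by (simp add: num_accepted_from_def num_accepted_def)
qed

text \<open>Accepted words are sorted by the state \<open>p\<close> reached after the first letter;
  the number of such letters is a transfer matrix entry.\<close>

lemma num_accepted_from_Suc: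
  assumes "wf_automaton A" "q \<in> states A"
  shows "num_accepted_from A q (Suc k) =
    (\<Sum>p\<in>states A. card {b \<in> {0, 1}. trans A q b = Some p} * num_accepted_from A p k)"
proof -
  define W where "W p = {w. length w = k \<and> set w \<subseteq> {0, 1} \<and> accepts (A\<lparr>init := p\<rparr>) w}" for p
  define E where "E p = {b \<in> {0, 1}. trans A q b = Some p}" for p
  have fin: "finite (states A)" and
    closed: "\<And>b p. b \<in> {0, 1} \<Longrightarrow> trans A q b = Some p \<Longrightarrow> p \<in> states A"
    using assms unfolding wf_automaton_def by blast+
  have "{w. length w = Suc k \<and> set w \<subseteq> {0, 1} \<and> accepts (A\<lparr>init := q\<rparr>) w} =
      (\<lambda>(b, w). b # w) ` (\<Union>p\<in>states A. E p \<times> W p)" (is "?L = ?R")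
  proof
    show "?L \<subseteq> ?R"
    proof
      fix x assume "x \<in> ?L"
      then obtain b w p where x: "x = b # w" "length w = k" "set w \<subseteq> {0, 1}" "b \<in> {0, 1}"
        and p: "trans A q b = Some p" "accepts (A\<lparr>init := p\<rparr>) w"
        by (cases x) (auto simp: accepts_Cons)
      then have "p \<in> states A" "(b, w) \<in> E p \<times> W p"
        using closed by (auto simp: E_def W_def)
      then show "x \<in> ?R" using x(1) by force
    qed
    show "?R \<subseteq> ?L"
      by (auto simp: E_def W_def accepts_Cons)
  qed
  then have "num_accepted_from A q (Suc k) = card (\<Union>p\<in>states A. E p \<times> W p)"
    by (simp add: num_accepted_from_def num_accepted_def card_image inj_on_def)
  also have "\<dots> = (\<Sum>p\<in>states A. card (E p \<times> W p))"
  proof (rule card_UN_disjoint[OF fin])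
    have "finite (E p)" "finite (W p)" for p
      using finite_subset[OF _ finite_binary_words[of k], of "W p"] by (auto simp: E_def W_def)
    then show "\<forall>p\<in>states A. finite (E p \<times> W p)" by blast
    \<comment> \<open>Determinism enters here: one letter cannot lead from \<open>q\<close> to two
      states.\<close>
    show "\<forall>p\<in>states A. \<forall>p'\<in>states A. p \<noteq> p' \<longrightarrow> E p \<times> W p \<inter> E p' \<times> W p' = {}"
      by (auto simp: E_def)
  qed
  finally show ?thesis
    by (simp add: card_cartesian_product E_def W_def num_accepted_from_def num_accepted_def)
qed

theorem proposition5p1:
  fixes A :: "'q automaton"
  assumes "wf_automaton A"
  shows "(\<forall>k. card {C \<in> residue_classes k. accepts A (class_parity_vector k C)} = num_accepted A k) \<and>
    (\<forall>e. bij_betw e {..<card (states A)} (states A) \<longrightarrow>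
      (let d = card (states A);
           M = transfer_matrix A e;
           u = indicator_vec A e {init A};
           v = indicator_vec A e (accepting A);
           c = coeff (char_poly M)
       in (\<forall>k. int (num_accepted A k) = u \<bullet> ((M ^\<^sub>m k) *\<^sub>v v)) \<and>
          char_poly M = monom 1 d + (\<Sum>i<d. monom (c i) i) \<and>
          (\<forall>k. int (num_accepted A (k + d)) + (\<Sum>i<d. c i * int (num_accepted A (k + i))) = 0)))"
proof -
  {
    fix e :: "nat \<Rightarrow> 'q" and k
    define d where "d = card (states A)"
    define M where "M = transfer_matrix A e"
    define f where "f i k = int (num_accepted_from A (e i) k)" for i k
    assume "bij_betw e {..<card (states A)} (states A)"
    then have e: "bij_betw e {..<d} (states A)" by (simp add: d_def)
    have M: "M \<in> carrier_mat d d" by (simp add: M_def d_def transfer_matrix_def)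
    have f: "f i (Suc k) = (\<Sum>j<d. M $$ (i, j) * f j k)" if "i < d" for i k
    proof -
      have "e i \<in> states A" using e that by (auto simp: bij_betw_def)
      then have "f i (Suc k) = (\<Sum>p\<in>states A.
          int (card {b \<in> {0, 1}. trans A (e i) b = Some p}) * int (num_accepted_from A p k))"
        by (simp only: f_def num_accepted_from_Suc[OF assms] of_nat_sum of_nat_mult)
      also have "\<dots> = (\<Sum>j<d. M $$ (i, j) * f j k)"
        using that by (subst sum.reindex_bij_betw[OF e, symmetric], intro sum.cong)
          (simp_all add: M_def f_def transfer_matrix_def d_def)
      finally show ?thesis .
    qed
    have "init A \<in> e ` {..<d}"
      using assms e by (simp add: wf_automaton_def bij_betw_imp_surj_on)
    then obtain l where l: "l < d" "e l = init A" by auto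
    then have num: "int (num_accepted A k) = f l k" for k
      by (simp add: f_def num_accepted_from_def)
    \<comment> \<open>Injectivity of \<open>e\<close> makes \<open>l\<close> the only index of the
      initial state, so the scalar product with this vector picks out entry
      \<open>l\<close>.\<close>
    have u: "indicator_vec A e {init A} = unit_vec d l"
      using l e unfolding indicator_vec_def unit_vec_def d_def[symmetric]
      by (intro eq_vecI) (auto simp: bij_betw_def inj_on_def)
    \<comment> \<open>The empty word is accepted exactly from the accepting states, so this is the
      initial vector of the system.\<close>
    have v: "indicator_vec A e (accepting A) = vec d (\<lambda>i. f i 0)"
      by (auto simp: indicator_vec_def d_def f_def num_accepted_from_0)
    have "int (num_accepted A k) =
        indicator_vec A e {init A} \<bullet> ((M ^\<^sub>m k) *\<^sub>v indicator_vec A e (accepting A))"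
      using l(1) by (simp add: u v pow_mat_mult_vec_system[where f = f, OF M f] num)
    moreover have "char_poly M = monom 1 d + (\<Sum>i<d. monom (coeff (char_poly M) i) i)"
      using M by (rule char_poly_eq_monom_sum)
    \<comment> \<open>Since \<open>char_poly M\<close> is monic of degree \<open>d\<close>, its top
      term acting on \<open>f l\<close> is \<open>f l (k + d)\<close>.\<close>
    moreover have "int (num_accepted A (k + d)) +
        (\<Sum>i<d. coeff (char_poly M) i * int (num_accepted A (k + i))) = 0"
      using char_poly_shift_act[where f = f and k = k, OF M f l(1)] degree_monic_char_poly[OF M]
      by (simp add: shift_act_def num lessThan_Suc_atMost[symmetric])
    ultimately have "int (num_accepted A k) =
          indicator_vec A e {init A} \<bullet> ((M ^\<^sub>m k) *\<^sub>v indicator_vec A e (accepting A)) \<and>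
        char_poly M = monom 1 d + (\<Sum>i<d. monom (coeff (char_poly M) i) i) \<and>
        int (num_accepted A (k + d)) +
          (\<Sum>i<d. coeff (char_poly M) i * int (num_accepted A (k + i))) = 0"
      by blast
    note this[unfolded M_def d_def]
  }
  then show ?thesis
    using card_accepted_residue_classes unfolding Let_def by blast
qed

end
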